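(* Every almost convergent real sequence is GAS convergent with the same limit; that is, if $x\in l_\infty$ is almost convergent to $\kappa$, then $x$ is GAS convergent to $\kappa$. In particular $\mathcal A\subset\mathcal S$.
   Context: $l_\infty$ is the normed linear space of all bounded real sequences $x=(x_n)_{n\in\mathbb N}$, $\mathbb N=\{1,2,3,\dots\}$, with the norm $\|x\|_\infty=\sup_n|x_n|$; $c\subset l_\infty$ is the subspace of convergent sequences. $S$ is the shift operator $S((x_n)_{n=1}^\infty)=(x_n)_{n=2}^\infty$. A linear functional $B:l_\infty\to\mathbb R$ is a Banach limit functional if: (i) $\|B\|=1$; (ii) $B(x)=\lim_{n\to\infty}x_n$ for all $x\in c$; (iii) $B(x)\ge0$ whenever $x\in l_\infty$ and $x_n\ge0$ for all $n$; (iv) $B(x)=B(Sx)$ for all $x\in l_\infty$. A sequence $x\in l_\infty$ is almost convergent to $\kappa$ if $B(x)=\kappa$ for all Banach limit functionals $B$. $\mathcal A$ is the set of all almost convergent real sequences. For $P\subset\mathbb N$, the natural density is $\delta(P)=\lim_{n\to\infty}\frac{|P\cap\{1,\dots,n\}|}{n}$ when the limit exists. A condition holds for "a.a.$k$" (almost all $k$) if the set $E$ of $k\in\mathbb N$ for which it fails has $\delta(E)=0$. A real sequence $(p_k)$ converges statistically to $\ell\in\mathbb R$, written $\mathrm{stat}\lim_{n\to\infty} p_n=\ell$, if for every $\epsilon>0$, $\delta(\{k\in\mathbb N:|p_k-\ell|>\epsilon\})=0$. $st\subset l_\infty$ is the subspace of all bounded statistically convergent real sequences, and $g:st\to\mathbb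 R$, $g(x)=\mathrm{stat}\lim_{n\to\infty}x_n$, is the statistical limit functional. A linear functional $\mathcal F:l_\infty\to\mathbb R$ is a Banach statistical limit functional if: (i) $\|\mathcal F\|=1$; (ii) $\mathcal F|_{st}=g$; (iii) if $s\in l_\infty$ with $s_n\ge0$ a.a.$n$, then $\mathcal F(s)\ge0$; (iv) for every $x\in l_\infty$, $\mathcal F(x)=\mathcal F(Tx)$ for every map $T:l_\infty\to l_\infty$ such that $(Ty)_k=(Sy)_k$ a.a.$k$ for each $y\in l_\infty$. A sequence $x\in l_\infty$ is generalized almost statistically (GAS) convergent to $\lambda$ if $\mathcal F(x)=\lambda$ for all Banach statistical limit functionals $\mathcal F$. $\mathcal S$ is the set of all GAS convergent real sequences. *)

theory Defs
  imports "HOL-Analysis.Analysis"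
begin

text \<open>
  Since \<^typ>\<open>nat\<close> carries the discrete topology, every sequence is continuous, so the bounded
  continuous functions on \<^typ>\<open>nat\<close> with the supremum norm are exactly the bounded sequences.

  Indexing convention: \<^term>\<open>x k\<close> with \<open>k = 0, 1, 2, \<dots>\<close> is the entry written \<open>x\<^sub>k\<^sub>+\<^sub>1\<close> in a numbering
  that starts from 1. Accordingly a set of positions is a set of zero-based indices, and the
  initial segment \<open>{1, \<dots>, n}\<close> becomes \<^term>\<open>{..<n}\<close>.
\<close>

type_synonym linf = "nat \<Rightarrow>\<^sub>C real"

definition linf_shift :: "linf \<Rightarrow> linf" where
  "linf_shift x = Bcontfun (\<lambda>n. apply_bcontfun x (Suc n))"

lemma apply_linf_shift [simp]: "apply_bcontfun (linf_shift x) n = apply_bcontfun x (Suc n)"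
proof -
  have "bounded (range (\<lambda>n. apply_bcontfun x (Suc n)))"
    by (rule bounded_subset [OF bounded_apply_bcontfun [of x]]) auto
  then have "(\<lambda>n. apply_bcontfun x (Suc n)) \<in> bcontfun"
    by (simp add: bcontfun_def)
  then show ?thesis
    by (simp add: linf_shift_def Bcontfun_inverse)
qed

definition has_natural_density :: "nat set \<Rightarrow> real \<Rightarrow> bool" where
  "has_natural_density P d \<longleftrightarrow> (\<lambda>n. real (card (P \<inter> {..<n})) / real n) \<longlonglongrightarrow> d"

definition almost_all :: "(nat \<Rightarrow> bool) \<Rightarrow> bool" where
  "almost_all Q \<longleftrightarrow> has_natural_density {k. \<not> Q k} 0"

definition stat_converges_to :: "(nat \<Rightarrow> real) \<Rightarrow> real \<Rightarrow> bool" where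
  "stat_converges_to p l \<longleftrightarrow> (\<forall>\<epsilon>>0. has_natural_density {k. \<bar>p k - l\<bar> > \<epsilon>} 0)"

lemma stat_converges_to_unique:
  assumes "stat_converges_to p l" and "stat_converges_to p m"
  shows "l = m"
proof (rule ccontr)
  assume "l \<noteq> m"
  define e where "e = \<bar>l - m\<bar> / 3"
  have e: "e > 0" using \<open>l \<noteq> m\<close> by (simp add: e_def)
  define A where "A = {k. \<bar>p k - l\<bar> > e}"
  define B where "B = {k. \<bar>p k - m\<bar> > e}"
  have "(\<lambda>n. real (card (A \<inter> {..<n})) / real n + real (card (B \<inter> {..<n})) / real n) \<longlonglongrightarrow> 0 + 0"
    using assms e
    by (intro tendsto_add) (auto simp: stat_converges_to_def has_natural_density_def A_def B_def)
  moreover have "1 \<le> real (card (A \<inter> {..<n})) / real n + real (card (B \<inter> {..<n})) / real n"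
    if "n \<ge> 1" for n
  proof -
    have "\<bar>p k - l\<bar> > e \<or> \<bar>p k - m\<bar> > e" for k
    proof -
      have "\<bar>l - m\<bar> \<le> \<bar>p k - l\<bar> + \<bar>p k - m\<bar>" by arith
      moreover have "\<bar>l - m\<bar> = 3 * e" by (simp add: e_def)
      ultimately show ?thesis using e by linarith
    qed
    then have "{..<n} = (A \<inter> {..<n}) \<union> (B \<inter> {..<n})"
      by (auto simp: A_def B_def)
    then have "n \<le> card (A \<inter> {..<n}) + card (B \<inter> {..<n})"
      by (metis card_Un_le card_lessThan)
    then have "real n \<le> real (card (A \<inter> {..<n})) + real (card (B \<inter> {..<n}))"
      by linarith
    then show ?thesis
      using that by (simp add: field_simps)
  qed
  ultimately have "(1::real) \<le> 0 + 0"
    by (intro LIMSEQ_le_const) auto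
  then show False by simp
qed

definition stat_lim :: "(nat \<Rightarrow> real) \<Rightarrow> real" where
  "stat_lim p = (THE l. stat_converges_to p l)"

lemma stat_lim_eq: "stat_converges_to p l \<Longrightarrow> stat_lim p = l"
  unfolding stat_lim_def by (blast intro: stat_converges_to_unique)

definition st :: "linf set" where
  "st = {x. \<exists>l. stat_converges_to (apply_bcontfun x) l}"

text \<open>
  A linear functional of norm 1 is in particular bounded, so functionals are taken from the dual
  space \<^typ>\<open>linf \<Rightarrow>\<^sub>L real\<close>, whose norm is the operator norm.
\<close>

definition Banach_limit :: "(linf \<Rightarrow>\<^sub>L real) \<Rightarrow> bool" where
  "Banach_limit B \<longleftrightarrow>
     norm B = 1 \<and>
     (\<forall>x. convergent (apply_bcontfun x) \<longrightarrow> blinfun_apply B x = lim (apply_bcontfun x)) \<and>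
     (\<forall>x. (\<forall>n. apply_bcontfun x n \<ge> 0) \<longrightarrow> blinfun_apply B x \<ge> 0) \<and>
     (\<forall>x. blinfun_apply B x = blinfun_apply B (linf_shift x))"

definition almost_convergent_to :: "linf \<Rightarrow> real \<Rightarrow> bool" where
  "almost_convergent_to x \<kappa> \<longleftrightarrow> (\<forall>B. Banach_limit B \<longrightarrow> blinfun_apply B x = \<kappa>)"

definition almost_convergent_seqs :: "linf set" where
  "almost_convergent_seqs = {x. \<exists>\<kappa>. almost_convergent_to x \<kappa>}"

text \<open>In the last condition \<open>T\<close> ranges over arbitrary, not necessarily linear or continuous, maps.\<close>

definition Banach_stat_limit :: "(linf \<Rightarrow>\<^sub>L real) \<Rightarrow> bool" where
  "Banach_stat_limit F \<longleftrightarrow>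
     norm F = 1 \<and>
     (\<forall>x\<in>st. blinfun_apply F x = stat_lim (apply_bcontfun x)) \<and>
     (\<forall>s. almost_all (\<lambda>n. apply_bcontfun s n \<ge> 0) \<longrightarrow> blinfun_apply F s \<ge> 0) \<and>
     (\<forall>x. \<forall>T :: linf \<Rightarrow> linf.
        (\<forall>y. almost_all (\<lambda>k. apply_bcontfun (T y) k = apply_bcontfun (linf_shift y) k)) \<longrightarrow>
        blinfun_apply F x = blinfun_apply F (T x))"

text \<open>GAS stands for generalized almost statistical convergence.\<close>

definition GAS_convergent_to :: "linf \<Rightarrow> real \<Rightarrow> bool" where
  "GAS_convergent_to x l \<longleftrightarrow> (\<forall>F. Banach_stat_limit F \<longrightarrow> blinfun_apply F x = l)"

definition GAS_convergent_seqs :: "linf set" where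
  "GAS_convergent_seqs = {x. \<exists>l. GAS_convergent_to x l}"

end

theory Submission
  imports Defs
begin

text \<open>
  Every Banach statistical limit functional is a Banach limit functional, so a value shared by all
  Banach limit functionals is in particular shared by all Banach statistical limit functionals.
  The inclusion of the two classes rests on the fact that finite sets of positions have natural
  density 0: a convergent sequence is therefore statistically convergent to its ordinary limit,
  and a property that holds at every position holds almost everywhere. In particular the shift
  itself is one of the maps that agree almost everywhere with the shift, so the invariance demanded
  of a Banach statistical limit functional contains ordinary shift invariance.
\<close>

lemma has_natural_density_finite:
  assumes "finite P"
  shows "has_natural_density P 0"
  unfolding has_natural_density_def
proof (rule tendsto_sandwich)
  show "\<forall>\<^sub>F n in sequentially. 0 \<le> real (card (P \<inter> {..<n})) / real n"
    by simp
  show "\<forall>\<^sub>F n in sequentially. real (card (P \<inter> {..<n})) / real n \<le> real (card P) / real n"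
    using assms by (intro always_eventually allI divide_right_mono) (auto intro: card_mono)
  show "(\<lambda>n. real (card P) / real n) \<longlonglongrightarrow> 0"
    by (rule lim_const_over_n)
qed simp

lemma almost_all_if_all: "(\<And>k. Q k) \<Longrightarrow> almost_all Q"
  by (simp add: almost_all_def has_natural_density_finite)

text \<open>
  Only finitely many terms of a convergent sequence lie further than a given \<open>\<epsilon> > 0\<close> from its limit.
\<close>

lemma LIMSEQ_imp_stat_converges_to:
  assumes "p \<longlonglongrightarrow> l"
  shows "stat_converges_to p l"
  unfolding stat_converges_to_def
proof (intro allI impI has_natural_density_finite)
  fix \<epsilon> :: real
  assume "\<epsilon> > 0"
  then obtain N where "\<And>k. k \<ge> N \<Longrightarrow> \<bar>p k - l\<bar> < \<epsilon>"
    using LIMSEQ_D [OF assms] by auto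
  then have "{k. \<bar>p k - l\<bar> > \<epsilon>} \<subseteq> {..<N}"
    by (force simp: not_less [symmetric])
  then show "finite {k. \<bar>p k - l\<bar> > \<epsilon>}"
    by (rule finite_subset) simp
qed

lemma Banach_stat_limit_imp_Banach_limit:
  assumes "Banach_stat_limit F"
  shows "Banach_limit F"
  unfolding Banach_limit_def
proof (intro conjI allI impI)
  show "norm F = 1"
    using assms by (simp add: Banach_stat_limit_def)
next
  fix x :: linf
  assume "convergent (apply_bcontfun x)"
  then have "stat_converges_to (apply_bcontfun x) (lim (apply_bcontfun x))"
    by (simp add: LIMSEQ_imp_stat_converges_to convergent_LIMSEQ_iff)
  then show "blinfun_apply F x = lim (apply_bcontfun x)"
    using assms by (auto simp: Banach_stat_limit_def st_def stat_lim_eq)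
next
  fix x :: linf
  assume "\<forall>n. apply_bcontfun x n \<ge> 0"
  then show "blinfun_apply F x \<ge> 0"
    using assms by (simp add: Banach_stat_limit_def almost_all_if_all)
next
  fix x :: linf
  have "almost_all (\<lambda>k. apply_bcontfun (linf_shift y) k = apply_bcontfun (linf_shift y) k)" for y
    by (rule almost_all_if_all) (rule refl)
  then show "blinfun_apply F x = blinfun_apply F (linf_shift x)"
    using assms unfolding Banach_stat_limit_def by blast
qed

theorem lemma3p3:
  shows "(\<forall>(x :: linf) (\<kappa> :: real). almost_convergent_to x \<kappa> \<longrightarrow> GAS_convergent_to x \<kappa>) \<and>
         almost_convergent_seqs \<subseteq> GAS_convergent_seqs"
  using Banach_stat_limit_imp_Banach_limit
  unfolding almost_convergent_seqs_def GAS_convergent_seqs_def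
    almost_convergent_to_def GAS_convergent_to_def
  by blast

end
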